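(* Let $G$ be the stable LTI system with coefficient matrices $(A,B,C,D)$, let $\alpha<0$, and for each positive integer $N$ let $\overline{\gamma}_{a,\alpha,N}$ and $\overline{\overline{\gamma}}_{a,\alpha,N}$ be the upper bounds of $\|G\|_{2+}$ obtained with the positive filter of degree $N$ as defined in the context. Then for all positive integers $N_1\le N_2$, $$\overline{\gamma}_{a,\alpha,N_2}\le\overline{\gamma}_{a,\alpha,N_1},\qquad \overline{\overline{\gamma}}_{a,\alpha,N_2}\le\overline{\overline{\gamma}}_{a,\alpha,N_1}.$$
   Context: Notation: $\mathbb{S}^k$ is the set of $k\times k$ real symmetric matrices; $X\preceq 0$ means $X$ is negative semidefinite; $\otimes$ is the Kronecker product. $\mathrm{PSD}^k\subset\mathbb{S}^k$ is the positive semidefinite cone; $\mathrm{NN}^k=\{P\in\mathbb{S}^k: P\ge 0 \text{ entrywise}\}$; $\mathrm{PSD}^k+\mathrm{NN}^k$ is their Minkowski sum; $\mathrm{COP}^k=\{P\in\mathbb{S}^k:\ x^TPx\ge 0\ \text{for all } x\in\mathbb{R}^k \text{ with } x\ge 0 \text{ entrywise}\}$ is the copositive cone. System: $G$ is the continuous-time LTI system $\dot x(t)=Ax(t)+Bw(t)$, $x(0)=0$, $z(t)=Cx(t)+Dw(t)$, with $A\in\mathbb{R}^{n\times n}$, $B\in\mathbb{R}^{n\times n_w}$, $C\in\mathbb{R}^{n_z\times n}$, $D\in\mathbb{R}^{n_z\times n_w}$. Standing assumptions: $A$ is Hurwitz and $(A,B)$ is controllable. $\|G\|_{2+}=\sup\|z\|_2$,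 the supremum being over $L_2$ inputs $w$ on $[0,\infty)$ with $w(t)\ge0$ entrywise for all $t\ge 0$ and $\|w\|_2=1$, where $\|w\|_2=\sqrt{\int_0^\infty |w(t)|_2^2\,dt}$. Filter of degree $N$: let $J_{\alpha,N}\in\mathbb{R}^{N\times N}$ be the upper-triangular Jordan block with $\alpha$ on the diagonal, $1$ on the first superdiagonal and $0$ elsewhere, and let $E_N=[0,\dots,0,1]^T\in\mathbb{R}^N$. Put $n_p=Nn_w$, $A_p=J_{\alpha,N}\otimes I_{n_w}\in\mathbb{R}^{Nn_w\times Nn_w}$, $B_p=E_N\otimes I_{n_w}\in\mathbb{R}^{Nn_w\times n_w}$, and $$A_a=\begin{bmatrix}A&0\\ 0&A_p\end{bmatrix},\quad B_a=\begin{bmatrix}B\\ B_p\end{bmatrix},\quad C_a=\begin{bmatrix}C&0_{n_z,n_p}\end{bmatrix},\quad D_a=D.$$ Consider the inequality $$(\ast)\quad\begin{bmatrix} P_aA_a + A_a^T P_a + C_a^T C_a & P_aB_a + C_a^T D_a \\ B_a^T P_a + D_a^T C_a & D_a^T D_a- \gamma ^2 I_{n_w} \end{bmatrix} + \begin{bmatrix} 0_{n,n_p+n_w} \\ I_{n_p+n_w} \end{bmatrix} Q_a \begin{bmatrix} 0_{n,n_p+n_w} \\ I_{n_p+n_w} \end{bmatrix}^T \preceq 0 .$$ $\overline{\gamma}_{a,\alpha,N}$ is the infimum of $\gamma>0$ such that $(\ast)$ holds for some $P_a\in\mathbb{S}^{n+n_p}$, $Q_a\in\mathrm{COP}^{n_p+n_w}$;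 $\overline{\overline{\gamma}}_{a,\alpha,N}$ is the infimum of $\gamma>0$ such that $(\ast)$ holds for some $P_a\in\mathbb{S}^{n+n_p}$, $Q_a\in\mathrm{PSD}^{n_p+n_w}+\mathrm{NN}^{n_p+n_w}$. *)

theory Defs
  imports
    "Jordan_Normal_Form.Jordan_Normal_Form"
    "HOL-Library.Extended_Real"
begin

text \<open>All matrices are those of Jordan_Normal_Form: dimensions are natural numbers, so the filter
  degree may vary within a formula. The orders \<open>\<le>\<close> on \<open>mat\<close> and \<open>vec\<close> are entrywise and
  require equal dimensions.\<close>

definition sym_mats :: "nat \<Rightarrow> real mat set" where
  "sym_mats k = {P \<in> carrier_mat k k. transpose_mat P = P}"

definition psd_cone :: "nat \<Rightarrow> real mat set" where
  "psd_cone k = {P \<in> sym_mats k. \<forall>x \<in> carrier_vec k. 0 \<le> x \<bullet> (P *\<^sub>v x)}"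

definition nn_cone :: "nat \<Rightarrow> real mat set" where
  "nn_cone k = {P \<in> sym_mats k. 0\<^sub>m k k \<le> P}"

definition psd_plus_nn :: "nat \<Rightarrow> real mat set" where
  "psd_plus_nn k = {P + Q | P Q. P \<in> psd_cone k \<and> Q \<in> nn_cone k}"

definition cop_cone :: "nat \<Rightarrow> real mat set" where
  "cop_cone k = {P \<in> sym_mats k. \<forall>x \<in> carrier_vec k. 0\<^sub>v k \<le> x \<longrightarrow> 0 \<le> x \<bullet> (P *\<^sub>v x)}"

definition neg_semidef :: "real mat \<Rightarrow> bool" where
  "neg_semidef X \<longleftrightarrow> X \<in> sym_mats (dim_row X) \<and>
     (\<forall>x \<in> carrier_vec (dim_row X). x \<bullet> (X *\<^sub>v x) \<le> 0)"

definition kronecker :: "real mat \<Rightarrow> real mat \<Rightarrow> real mat" where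
  "kronecker X Y = mat (dim_row X * dim_row Y) (dim_col X * dim_col Y)
     (\<lambda>(i, j). X $$ (i div dim_row Y, j div dim_col Y) * Y $$ (i mod dim_row Y, j mod dim_col Y))"

definition hurwitz :: "real mat \<Rightarrow> bool" where
  "hurwitz A \<longleftrightarrow> (\<forall>l. eigenvalue (map_mat complex_of_real A) l \<longrightarrow> Re l < 0)"

text \<open>Controllability of \<open>x' = A x + B w\<close>: every state can be steered to every other state in every
  positive time. For finite-dimensional LTI systems it makes no difference whether the inputs are
  taken to be continuous, piecewise continuous or square integrable.\<close>

definition controllable :: "real mat \<Rightarrow> real mat \<Rightarrow> bool" where
  "controllable A B \<longleftrightarrow>
     (\<forall>x0 \<in> carrier_vec (dim_row A). \<forall>x1 \<in> carrier_vec (dim_row A). \<forall>T>0.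
        \<exists>(w :: real \<Rightarrow> real vec) (x :: real \<Rightarrow> real vec).
          (\<forall>t \<in> {0..T}. w t \<in> carrier_vec (dim_col B) \<and> x t \<in> carrier_vec (dim_row A)) \<and>
          (\<forall>j < dim_col B. continuous_on {0..T} (\<lambda>t. w t $ j)) \<and>
          (\<forall>t \<in> {0..T}. \<forall>i < dim_row A.
             ((\<lambda>s. x s $ i) has_real_derivative (A *\<^sub>v x t + B *\<^sub>v w t) $ i) (at t within {0..T})) \<and>
          x 0 = x0 \<and> x T = x1)"

definition filter_A :: "real \<Rightarrow> nat \<Rightarrow> nat \<Rightarrow> real mat" where
  "filter_A \<alpha> N nw = kronecker (jordan_block N \<alpha>) (1\<^sub>m nw)"

definition filter_B :: "nat \<Rightarrow> nat \<Rightarrow> real mat" where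
  "filter_B N nw = kronecker (mat N 1 (\<lambda>(i, j). if Suc i = N then 1 else 0)) (1\<^sub>m nw)"

definition aug_A :: "real mat \<Rightarrow> real \<Rightarrow> nat \<Rightarrow> nat \<Rightarrow> real mat" where
  "aug_A A \<alpha> N nw = four_block_mat A (0\<^sub>m (dim_row A) (N * nw)) (0\<^sub>m (N * nw) (dim_col A)) (filter_A \<alpha> N nw)"

definition aug_B :: "real mat \<Rightarrow> nat \<Rightarrow> real mat" where
  "aug_B B N = B @\<^sub>r filter_B N (dim_col B)"

text \<open>The row block \<open>[C, 0]\<close>, written as a four-block matrix whose lower blocks have no rows.\<close>

definition aug_C :: "real mat \<Rightarrow> nat \<Rightarrow> real mat" where
  "aug_C C np = four_block_mat C (0\<^sub>m (dim_row C) np) (0\<^sub>m 0 (dim_col C)) (0\<^sub>m 0 np)"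

definition lmi_mat ::
  "real mat \<Rightarrow> real mat \<Rightarrow> real mat \<Rightarrow> real mat \<Rightarrow> real \<Rightarrow> nat \<Rightarrow> real \<Rightarrow> real mat \<Rightarrow> real mat \<Rightarrow> real mat" where
  "lmi_mat A B C D \<alpha> N \<gamma> Pa Qa =
     (let n = dim_row A; nw = dim_col B; np = N * nw;
          Aa = aug_A A \<alpha> N nw; Ba = aug_B B N; Ca = aug_C C np; Da = D;
          S = 0\<^sub>m n (np + nw) @\<^sub>r 1\<^sub>m (np + nw)
      in four_block_mat
           (Pa * Aa + transpose_mat Aa * Pa + transpose_mat Ca * Ca)
           (Pa * Ba + transpose_mat Ca * Da)
           (transpose_mat Ba * Pa + transpose_mat Da * Ca)
           (transpose_mat Da * Da - \<gamma>\<^sup>2 \<cdot>\<^sub>m 1\<^sub>m nw)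
         + S * Qa * transpose_mat S)"

text \<open>The infimum is taken in the extended reals, so that the infimum over an empty set
  is \<open>\<infinity>\<close>. The multiplier \<open>Qa\<close> ranges over the members of the cone family \<open>K\<close> of the right size.\<close>

definition filter_bound ::
  "(nat \<Rightarrow> real mat set) \<Rightarrow> real mat \<Rightarrow> real mat \<Rightarrow> real mat \<Rightarrow> real mat \<Rightarrow> real \<Rightarrow> nat \<Rightarrow> ereal" where
  "filter_bound K A B C D \<alpha> N =
     Inf (ereal ` {\<gamma>. \<gamma> > 0 \<and>
       (\<exists>Pa \<in> sym_mats (dim_row A + N * dim_col B). \<exists>Qa \<in> K (N * dim_col B + dim_col B).
          neg_semidef (lmi_mat A B C D \<alpha> N \<gamma> Pa Qa))})"

definition gamma_cop :: "real mat \<Rightarrow> real mat \<Rightarrow> real mat \<Rightarrow> real mat \<Rightarrow> real \<Rightarrow> nat \<Rightarrow> ereal" where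
  "gamma_cop = filter_bound cop_cone"

definition gamma_psd_nn :: "real mat \<Rightarrow> real mat \<Rightarrow> real mat \<Rightarrow> real mat \<Rightarrow> real \<Rightarrow> nat \<Rightarrow> ereal" where
  "gamma_psd_nn = filter_bound psd_plus_nn"

end

theory Submission
  imports Defs
begin

text \<open>
  Split the state of the filter of degree \<open>N\<close> into \<open>N\<close> blocks of the size of the input. They form a
  chain: \<open>p\<^sub>i' = \<alpha> p\<^sub>i + p\<^sub>i\<^sub>+\<^sub>1\<close> for \<open>i < N\<close>, and the input enters only at the end,
  \<open>p\<^sub>N' = \<alpha> p\<^sub>N + w\<close>. No block is driven by an earlier one, so the last \<open>N1\<close> blocks of the filter of
  degree \<open>N2\<close> are by themselves a filter of degree \<open>N1\<close>.

  Hence the matrix \<open>T\<close> that deletes the first \<open>N2 - N1\<close> filter blocks from the augmented state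
  intertwines the two augmented systems: \<open>T A\<^sub>2 = A\<^sub>1 T\<close>, \<open>T B\<^sub>2 = B\<^sub>1\<close> and \<open>C\<^sub>2 = C\<^sub>1 T\<close>
  (lemmas \<open>drop_mat_aug_A\<close>, \<open>drop_mat_aug_B\<close>, \<open>aug_C_drop_mat\<close>). Given \<open>P\<close> and \<open>Q\<close> that certify \<open>\<gamma>\<close>
  in degree \<open>N1\<close>, the pulled back matrices \<open>T\<^sup>T P T\<close> and \<open>U\<^sup>T Q U\<close>, where \<open>U\<close> makes the same deletion in
  the coordinates of \<open>Q\<close>, certify \<open>\<gamma>\<close> in degree \<open>N2\<close>: the matrix of the inequality in degree \<open>N2\<close> is
  then \<open>V\<^sup>T M V\<close>, with \<open>M\<close> the matrix in degree \<open>N1\<close> and \<open>V\<close> the deletion on states and inputs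
  together (\<open>lmi_mat_congruence\<close>), and congruence preserves negative semidefiniteness.

  The pulled back multiplier stays in its cone because \<open>U\<close> is entrywise nonnegative: the copositive
  cone and \<open>PSD + NN\<close> are closed under congruence with nonnegative matrices. So every \<open>\<gamma>\<close> feasible in
  degree \<open>N1\<close> is feasible in degree \<open>N2\<close>, and the infimum can only decrease.
\<close>

section \<open>Congruences and the multiplier cones\<close>

text \<open>With equations between dimensions in place of carriers, associativity becomes a rewrite rule whose
  side conditions the simplifier discharges without guessing sizes.\<close>

lemma assoc_mult_mat_dims:
  fixes X Y Z :: "'a :: semiring_0 mat"
  assumes "dim_col X = dim_row Y" and "dim_col Y = dim_row Z"
  shows "X * Y * Z = X * (Y * Z)"
  using assms by (intro assoc_mult_mat[of _ "dim_row X" "dim_row Y" _ "dim_row Z" _ "dim_col Z"]) auto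

lemma congruence_sym_mats:
  assumes "Q \<in> sym_mats p" and "U \<in> carrier_mat p q"
  shows "transpose_mat U * Q * U \<in> sym_mats q"
proof -
  have Q: "Q \<in> carrier_mat p p" "transpose_mat Q = Q"
    using assms(1) by (auto simp: sym_mats_def)
  have "transpose_mat (transpose_mat U * Q * U) = transpose_mat U * (transpose_mat Q * U)"
    using Q(1) assms(2)
    by (simp add: transpose_mult[of "transpose_mat U * Q" q p U q] transpose_mult[of _ q p Q p]
        del: assoc_mult_mat)
  then show ?thesis
    using Q assms(2) by (simp add: sym_mats_def assoc_mult_mat_dims)
qed

lemma congruence_quadratic_form:
  fixes Q U :: "real mat"
  assumes "Q \<in> carrier_mat p p" and "U \<in> carrier_mat p q" and "x \<in> carrier_vec q"
  shows "x \<bullet> ((transpose_mat U * Q * U) *\<^sub>v x) = (U *\<^sub>v x) \<bullet> (Q *\<^sub>v (U *\<^sub>v x))"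
proof -
  have "(transpose_mat U * Q * U) *\<^sub>v x = transpose_mat U *\<^sub>v (Q *\<^sub>v (U *\<^sub>v x))"
    using assms by (simp add: assoc_mult_mat_vec[of _ q p _ p] assoc_mult_mat_vec[of _ q p _ q])
  moreover have "x \<bullet> (transpose_mat U *\<^sub>v (Q *\<^sub>v (U *\<^sub>v x))) = (transpose_mat (transpose_mat U) *\<^sub>v x) \<bullet> (Q *\<^sub>v (U *\<^sub>v x))"
    using assms by (intro transpose_vec_mult_scalar[symmetric, of _ p q] transpose_vec_mult_scalar[of _ q p, symmetric]) auto
  ultimately show ?thesis by simp
qed

lemma congruence_add:
  fixes R S U :: "'a :: semiring_0 mat"
  assumes "R \<in> carrier_mat p p" and "S \<in> carrier_mat p p" and "U \<in> carrier_mat p q"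
  shows "transpose_mat U * (R + S) * U = transpose_mat U * R * U + transpose_mat U * S * U"
  using assms
  by (simp add: mult_add_distrib_mat[of _ q p R p S] add_mult_distrib_mat[of _ q p _ U q]
      del: assoc_mult_mat)

lemma congruence_neg_semidef:
  assumes "neg_semidef X" and "X \<in> carrier_mat p p" and "V \<in> carrier_mat p q"
  shows "neg_semidef (transpose_mat V * X * V)"
  using assms congruence_sym_mats[of X p V q]
  by (auto simp: neg_semidef_def congruence_quadratic_form simp del: assoc_mult_mat)

lemma congruence_psd_cone:
  assumes "Q \<in> psd_cone p" and "U \<in> carrier_mat p q"
  shows "transpose_mat U * Q * U \<in> psd_cone q"
  using assms congruence_sym_mats[of Q p U q]
  by (auto simp: psd_cone_def sym_mats_def congruence_quadratic_form simp del: assoc_mult_mat)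

lemma nonneg_mult_mat:
  fixes X Y :: "real mat"
  assumes "0\<^sub>m p q \<le> X" and "0\<^sub>m q r \<le> Y"
  shows "0\<^sub>m p r \<le> X * Y"
  using assms by (auto simp: less_eq_mat_def scalar_prod_def intro!: sum_nonneg)

text \<open>This is all that the argument needs to know about a family of multiplier cones. The nonnegativity
  of \<open>U\<close> is essential: neither \<open>nn_cone\<close> nor \<open>cop_cone\<close> is closed under arbitrary congruences.\<close>

definition nonneg_congruence_closed :: "(nat \<Rightarrow> real mat set) \<Rightarrow> bool" where
  "nonneg_congruence_closed K \<longleftrightarrow>
     (\<forall>p q Q U. Q \<in> K p \<longrightarrow> U \<in> carrier_mat p q \<longrightarrow> 0\<^sub>m p q \<le> U \<longrightarrow>
        Q \<in> sym_mats p \<and> transpose_mat U * Q * U \<in> K q)"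

lemma nonneg_mult_vec:
  fixes X :: "real mat"
  assumes "0\<^sub>m p q \<le> X" and "0\<^sub>v q \<le> x"
  shows "0\<^sub>v p \<le> X *\<^sub>v x"
  using assms by (auto simp: less_eq_mat_def less_eq_vec_def scalar_prod_def intro!: sum_nonneg)

lemma nonneg_congruence_closed_cop_cone: "nonneg_congruence_closed cop_cone"
  unfolding nonneg_congruence_closed_def
proof (intro allI impI)
  fix p q and Q U :: "real mat"
  assume Q: "Q \<in> cop_cone p" and U: "U \<in> carrier_mat p q" "0\<^sub>m p q \<le> U"
  then have sym: "Q \<in> sym_mats p" and carr: "Q \<in> carrier_mat p p"
    by (auto simp: cop_cone_def sym_mats_def)
  have "0 \<le> x \<bullet> ((transpose_mat U * Q * U) *\<^sub>v x)" if x: "x \<in> carrier_vec q" "0\<^sub>v q \<le> x" for x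
    unfolding congruence_quadratic_form[OF carr U(1) x(1)]
    using Q nonneg_mult_vec[OF U(2) x(2)] mult_mat_vec_carrier[OF U(1) x(1)]
    by (simp add: cop_cone_def)
  then show "Q \<in> sym_mats p \<and> transpose_mat U * Q * U \<in> cop_cone q"
    using sym congruence_sym_mats[OF sym U(1)] by (simp add: cop_cone_def)
qed

lemma nonneg_congruence_closed_psd_plus_nn: "nonneg_congruence_closed psd_plus_nn"
  unfolding nonneg_congruence_closed_def
proof (intro allI impI)
  fix p q and Q U :: "real mat"
  assume "Q \<in> psd_plus_nn p" and U: "U \<in> carrier_mat p q" "0\<^sub>m p q \<le> U"
  then obtain R S where Q: "Q = R + S" and R: "R \<in> psd_cone p" and S: "S \<in> nn_cone p"
    by (auto simp: psd_plus_nn_def)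
  have RS: "R \<in> sym_mats p" "S \<in> sym_mats p" "R \<in> carrier_mat p p" "S \<in> carrier_mat p p"
    using R S by (auto simp: psd_cone_def nn_cone_def sym_mats_def)
  have "0\<^sub>m q p \<le> transpose_mat U"
    using U by (auto simp: less_eq_mat_def)
  then have "transpose_mat U * S * U \<in> nn_cone q"
    using S U(2) congruence_sym_mats[OF RS(2) U(1)]
    by (auto simp: nn_cone_def intro: nonneg_mult_mat)
  moreover have "transpose_mat U * Q * U = transpose_mat U * R * U + transpose_mat U * S * U"
    unfolding Q by (rule congruence_add[OF RS(3,4) U(1)])
  moreover have "Q \<in> sym_mats p"
    using RS by (auto simp: Q sym_mats_def transpose_add)
  ultimately show "Q \<in> sym_mats p \<and> transpose_mat U * Q * U \<in> psd_plus_nn q"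
    using congruence_psd_cone[OF R U(1)] by (auto simp: psd_plus_nn_def)
qed

section \<open>Truncation of the state\<close>

text \<open>Multiplying a vector by \<open>drop_mat n d m\<close> keeps its first \<open>n\<close> and last \<open>m\<close> entries and deletes the
  \<open>d\<close> entries between them. One family serves for \<open>T\<close>, for \<open>V\<close> (larger \<open>m\<close>), for \<open>U\<close> (\<open>n = 0\<close>) and,
  transposed, for the block column of a zero and an identity that places the multiplier.\<close>

definition drop_mat :: "nat \<Rightarrow> nat \<Rightarrow> nat \<Rightarrow> real mat" where
  "drop_mat n d m = mat (n + m) (n + d + m)
     (\<lambda>(i, j). if j = (if i < n then i else i + d) then 1 else 0)"

lemma drop_mat_carrier [simp]: "drop_mat n d m \<in> carrier_mat (n + m) (n + d + m)"
  by (simp add: drop_mat_def)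

lemma dim_drop_mat [simp]: "dim_row (drop_mat n d m) = n + m" "dim_col (drop_mat n d m) = n + d + m"
  by (simp_all add: drop_mat_def)

lemma drop_mat_nonneg: "0\<^sub>m (n + m) (n + d + m) \<le> drop_mat n d m"
  by (auto simp: less_eq_mat_def drop_mat_def)

lemma index_drop_mat_mult:
  assumes "dim_row M = n + d + m" and "i < n + m" and "j < dim_col M"
  shows "(drop_mat n d m * M) $$ (i, j) = M $$ (if i < n then i else i + d, j)"
proof -
  have "(drop_mat n d m * M) $$ (i, j) = (\<Sum>k\<in>{0..<n + d + m}. drop_mat n d m $$ (i, k) * M $$ (k, j))"
    using assms by (auto simp: scalar_prod_def intro!: sum.cong)
  also have "\<dots> = (\<Sum>k\<in>{0..<n + d + m}. if k = (if i < n then i else i + d) then M $$ (k, j) else 0)"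
    using assms by (intro sum.cong) (auto simp: drop_mat_def)
  also have "\<dots> = M $$ (if i < n then i else i + d, j)"
    using assms by (subst sum.delta) auto
  finally show ?thesis .
qed

lemma index_mult_drop_mat:
  assumes "dim_col M = n + m" and "i < dim_row M" and "j < n + d + m"
  shows "(M * drop_mat n d m) $$ (i, j) =
    (if j < n then M $$ (i, j) else if j < n + d then 0 else M $$ (i, j - d))"
proof -
  have "(M * drop_mat n d m) $$ (i, j) = (\<Sum>k\<in>{0..<n + m}. M $$ (i, k) * drop_mat n d m $$ (k, j))"
    using assms by (auto simp: scalar_prod_def intro!: sum.cong)
  also have "\<dots> = (\<Sum>k\<in>{0..<n + m}. if j = (if k < n then k else k + d) then M $$ (i, k) else 0)"
    using assms by (intro sum.cong) (auto simp: drop_mat_def)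
  also have "\<dots> = (\<Sum>k\<in>{0..<n + m}. if k = (if j < n then j else j - d) then
      (if j < n then M $$ (i, j) else if j < n + d then 0 else M $$ (i, j - d)) else 0)"
    using assms by (intro sum.cong) auto
  also have "\<dots> = (if j < n then M $$ (i, j) else if j < n + d then 0 else M $$ (i, j - d))"
    using assms by (subst sum.delta) auto
  finally show ?thesis .
qed

lemma drop_mat_four_block:
  "drop_mat n d (m + w) = four_block_mat (drop_mat n d m) (0\<^sub>m (n + m) w) (0\<^sub>m w (n + d + m)) (1\<^sub>m w)"
  by (rule eq_matI) (auto simp: drop_mat_def)

text \<open>Deleting \<open>n + d\<close> leading entries can be done in either order. This makes the multiplier term of the
  matrix inequality compatible with the truncation.\<close>

lemma drop_mat_compose:
  "drop_mat 0 d m * drop_mat 0 n (d + m) = drop_mat 0 n m * drop_mat n d m"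
  by (rule eq_matI)
     (simp_all add: index_drop_mat_mult del: index_mult_mat(1), auto simp: drop_mat_def)

lemma transpose_drop_mat_compose:
  "transpose_mat (drop_mat 0 n (d + m)) * transpose_mat (drop_mat 0 d m)
    = transpose_mat (drop_mat n d m) * transpose_mat (drop_mat 0 n m)"
proof -
  have "transpose_mat (drop_mat 0 d m * drop_mat 0 n (d + m))
      = transpose_mat (drop_mat 0 n (d + m)) * transpose_mat (drop_mat 0 d m)"
    by (rule transpose_mult[of _ m "d + m" _ "n + (d + m)"]) (simp_all add: carrier_matI)
  moreover have "transpose_mat (drop_mat 0 n m * drop_mat n d m)
      = transpose_mat (drop_mat n d m) * transpose_mat (drop_mat 0 n m)"
    by (rule transpose_mult[of _ m "n + m" _ "n + d + m"]) (simp_all add: carrier_matI)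
  ultimately show ?thesis by (simp only: drop_mat_compose)
qed

section \<open>The last blocks of a filter form a filter\<close>

lemma dim_filter [simp]:
  "dim_row (filter_A \<alpha> N w) = N * w" "dim_col (filter_A \<alpha> N w) = N * w"
  "dim_row (filter_B N w) = N * w" "dim_col (filter_B N w) = w"
  by (simp_all add: filter_A_def filter_B_def kronecker_def)

text \<open>The coefficients of the chain depend only on the difference of the block indices, so the lower right
  corner of the large filter matrix is the small one.\<close>

lemma filter_A_shift:
  assumes "i < N * w" and "j < N * w"
  shows "filter_A \<alpha> (k + N) w $$ (i + k * w, j + k * w) = filter_A \<alpha> N w $$ (i, j)"
proof -
  have w: "w > 0" using assms by (cases w) auto
  then have "i div w < N" "j div w < N"
    using assms by (auto simp: less_mult_imp_div_less)
  then show ?thesis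
    using assms w by (auto simp: filter_A_def kronecker_def jordan_block_def algebra_simps)
qed

text \<open>The Jordan block is upper triangular: the deleted blocks do not drive the retained ones.\<close>

lemma filter_A_lower_zero:
  assumes "i < N * w" and "j < k * w"
  shows "filter_A \<alpha> (k + N) w $$ (i + k * w, j) = 0"
proof -
  have w: "w > 0" using assms by (cases w) auto
  have "i div w < N" "j div w < k"
    using assms by (auto simp: less_mult_imp_div_less)
  then show ?thesis
    using assms w by (auto simp: filter_A_def kronecker_def jordan_block_def algebra_simps)
qed

text \<open>The input enters at the end of the chain, hence in the retained part, at the same distance from
  its end.\<close>

lemma filter_B_shift:
  assumes "i < N * w" and "j < w"
  shows "filter_B (k + N) w $$ (i + k * w, j) = filter_B N w $$ (i, j)"
proof -
  have "i div w < N"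
    using assms by (auto simp: less_mult_imp_div_less)
  then show ?thesis
    using assms by (auto simp: filter_B_def kronecker_def algebra_simps)
qed

lemma dim_aug [simp]:
  "dim_row (aug_A A \<alpha> N w) = dim_row A + N * w" "dim_col (aug_A A \<alpha> N w) = dim_col A + N * w"
  "dim_row (aug_B B N) = dim_row B + N * dim_col B" "dim_col (aug_B B N) = dim_col B"
  "dim_row (aug_C C m) = dim_row C" "dim_col (aug_C C m) = dim_col C + m"
  by (simp_all add: aug_A_def aug_B_def aug_C_def append_rows_def)

text \<open>The retained part of the augmented state evolves autonomously, with the dynamics of degree \<open>N\<close>.\<close>

lemma drop_mat_aug_A:
  assumes "A \<in> carrier_mat n n"
  shows "drop_mat n (k * w) (N * w) * aug_A A \<alpha> (k + N) w = aug_A A \<alpha> N w * drop_mat n (k * w) (N * w)"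
proof (rule eq_matI)
  fix i j
  assume "i < dim_row (aug_A A \<alpha> N w * drop_mat n (k * w) (N * w))"
    and "j < dim_col (aug_A A \<alpha> N w * drop_mat n (k * w) (N * w))"
  then have ij: "i < n + N * w" "j < n + k * w + N * w" using assms by auto
  have "filter_A \<alpha> (k + N) w $$ (i + k * w - n, j - n) = filter_A \<alpha> N w $$ (i - n, j - n - k * w)"
    if "i \<ge> n" "j \<ge> n + k * w"
    using filter_A_shift[of "i - n" N w "j - n - k * w" \<alpha> k] that ij by (simp add: algebra_simps)
  moreover have "filter_A \<alpha> (k + N) w $$ (i + k * w - n, j - n) = 0"
    if "i \<ge> n" "j \<ge> n" "j < n + k * w"
    using filter_A_lower_zero[of "i - n" N w "j - n" k \<alpha>] that ij by (simp add: algebra_simps)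
  ultimately show "(drop_mat n (k * w) (N * w) * aug_A A \<alpha> (k + N) w) $$ (i, j)
      = (aug_A A \<alpha> N w * drop_mat n (k * w) (N * w)) $$ (i, j)"
    using assms ij
    by (simp add: index_drop_mat_mult index_mult_drop_mat distrib_right del: index_mult_mat(1))
       (auto simp: aug_A_def distrib_right algebra_simps)
qed (use assms in \<open>auto simp: distrib_right\<close>)

lemma drop_mat_aug_B:
  assumes "B \<in> carrier_mat n w"
  shows "drop_mat n (k * w) (N * w) * aug_B B (k + N) = aug_B B N"
proof (rule eq_matI)
  fix i j
  assume "i < dim_row (aug_B B N)" and "j < dim_col (aug_B B N)"
  then have ij: "i < n + N * w" "j < w" using assms by auto
  have "filter_B (k + N) w $$ (i + k * w - n, j) = filter_B N w $$ (i - n, j)" if "i \<ge> n"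
    using filter_B_shift[of "i - n" N w j k] that ij by simp
  then show "(drop_mat n (k * w) (N * w) * aug_B B (k + N)) $$ (i, j) = aug_B B N $$ (i, j)"
    using assms ij
    by (simp add: index_drop_mat_mult distrib_right del: index_mult_mat(1))
       (auto simp: aug_B_def append_rows_def distrib_right algebra_simps)
qed (use assms in auto)

lemma aug_C_drop_mat:
  assumes "C \<in> carrier_mat z n"
  shows "aug_C C (d + m) = aug_C C m * drop_mat n d m"
  by (rule eq_matI)
     (use assms in \<open>simp_all add: index_mult_drop_mat del: index_mult_mat(1)\<close>, use assms in \<open>auto simp: aug_C_def\<close>)

section \<open>The matrix inequality under truncation\<close>

text \<open>The quadratic form of the block matrix at a state \<open>x\<close> and an input \<open>w\<close> is the derivative of the
  storage function \<open>x\<^sup>T P x\<close> along the system plus terms in the output and the input. If \<open>T\<close> intertwines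
  two systems, then the storage function \<open>x \<mapsto> (T x)\<^sup>T P (T x)\<close> has at \<open>x\<close> the derivative that \<open>P\<close> has
  at \<open>T x\<close>, the outputs agree, and so the form of the second system is that of the first at
  \<open>(T x, w)\<close>.\<close>

lemma kyp_block_congruence:
  fixes A1 B1 C1 D A2 B2 C2 T P R :: "real mat"
  assumes dims: "A1 \<in> carrier_mat p p" "B1 \<in> carrier_mat p w" "C1 \<in> carrier_mat z p" "D \<in> carrier_mat z w"
    "A2 \<in> carrier_mat q q" "B2 \<in> carrier_mat q w" "P \<in> carrier_mat p p" "R \<in> carrier_mat w w" "T \<in> carrier_mat p q"
    and A: "T * A2 = A1 * T" and B: "T * B2 = B1" and C: "C2 = C1 * T"
  defines "V \<equiv> four_block_mat T (0\<^sub>m p w) (0\<^sub>m w q) (1\<^sub>m w)"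
    and "P2 \<equiv> transpose_mat T * P * T"
  shows "four_block_mat
      (P2 * A2 + transpose_mat A2 * P2 + transpose_mat C2 * C2) (P2 * B2 + transpose_mat C2 * D)
      (transpose_mat B2 * P2 + transpose_mat D * C2) R
    = transpose_mat V * four_block_mat
      (P * A1 + transpose_mat A1 * P + transpose_mat C1 * C1) (P * B1 + transpose_mat C1 * D)
      (transpose_mat B1 * P + transpose_mat D * C1) R * V"
proof -
  have A': "transpose_mat A2 * transpose_mat T = transpose_mat T * transpose_mat A1"
    using dims A by (metis transpose_mult)
  have B': "transpose_mat B2 * transpose_mat T = transpose_mat B1"
    using dims B by (metis transpose_mult)
  have C': "transpose_mat C2 = transpose_mat T * transpose_mat C1"
    using dims C by (metis transpose_mult)
  note assoc = assoc_mult_mat_dims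
  \<comment> \<open>In each product the factor \<open>T\<close> is moved through the coefficients of the second system, which turns
    them into those of the first.\<close>
  have PA: "P2 * A2 = transpose_mat T * (P * A1) * T"
    using dims by (simp add: P2_def assoc A)
  have AP: "transpose_mat A2 * P2 = transpose_mat T * (transpose_mat A1 * P) * T"
  proof -
    have "transpose_mat A2 * P2 = (transpose_mat A2 * transpose_mat T) * (P * T)"
      using dims by (simp add: P2_def assoc)
    then show ?thesis using dims by (simp add: A' assoc)
  qed
  have CC: "transpose_mat C2 * C2 = transpose_mat T * (transpose_mat C1 * C1) * T"
    unfolding C' unfolding C using dims by (simp add: assoc)
  have PB: "P2 * B2 = transpose_mat T * (P * B1)"
    using dims by (simp add: P2_def assoc B)
  have BP: "transpose_mat B2 * P2 = transpose_mat B1 * P * T"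
  proof -
    have "transpose_mat B2 * P2 = (transpose_mat B2 * transpose_mat T) * (P * T)"
      using dims by (simp add: P2_def assoc)
    then show ?thesis using dims by (simp add: B' assoc)
  qed
  have CD: "transpose_mat C2 * D = transpose_mat T * (transpose_mat C1 * D)"
    unfolding C' using dims by (simp add: assoc)
  have DC: "transpose_mat D * C2 = transpose_mat D * C1 * T"
    unfolding C using dims by (simp add: assoc)
  define M11 M12 M21 where
    "M11 = P * A1 + transpose_mat A1 * P + transpose_mat C1 * C1"
    and "M12 = P * B1 + transpose_mat C1 * D"
    and "M21 = transpose_mat B1 * P + transpose_mat D * C1"
  have M: "M11 \<in> carrier_mat p p" "M12 \<in> carrier_mat p w" "M21 \<in> carrier_mat w p"
    using dims by (auto simp: M11_def M12_def M21_def)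
  have b11: "P2 * A2 + transpose_mat A2 * P2 + transpose_mat C2 * C2 = transpose_mat T * M11 * T"
    unfolding PA AP CC M11_def using dims
    by (simp add: mult_add_distrib_mat[of _ q p _ p] add_mult_distrib_mat[of _ q p _ _ q])
  have b12: "P2 * B2 + transpose_mat C2 * D = transpose_mat T * M12"
    unfolding PB CD M12_def using dims
    by (simp add: mult_add_distrib_mat[of _ q p _ w])
  have b21: "transpose_mat B2 * P2 + transpose_mat D * C2 = M21 * T"
    unfolding BP DC M21_def using dims
    by (simp add: add_mult_distrib_mat[of _ w p _ _ q])
  have Vt: "transpose_mat V = four_block_mat (transpose_mat T) (0\<^sub>m q w) (0\<^sub>m w p) (1\<^sub>m w)"
    unfolding V_def using dims
    by (subst transpose_four_block_mat[of _ p q _ w _ w]) auto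
  have "transpose_mat V * four_block_mat M11 M12 M21 R
      = four_block_mat (transpose_mat T * M11) (transpose_mat T * M12) M21 R"
    unfolding Vt using dims M
    by (subst mult_four_block_mat[of _ q p _ w _ w _ _ p _ w]) auto
  moreover have "four_block_mat (transpose_mat T * M11) (transpose_mat T * M12) M21 R * V
      = four_block_mat (transpose_mat T * M11 * T) (transpose_mat T * M12) (M21 * T) R"
    unfolding V_def using dims M
    by (subst mult_four_block_mat[of _ q p _ w _ w _ _ q _ w]) auto
  ultimately show ?thesis
    unfolding b11 b12 b21 M11_def[symmetric] M12_def[symmetric] M21_def[symmetric] by simp
qed

lemma embedding_eq_transpose_drop_mat:
  "0\<^sub>m n m @\<^sub>r 1\<^sub>m m = transpose_mat (drop_mat 0 n m)"
  by (rule eq_matI) (auto simp: append_rows_def drop_mat_def)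

text \<open>Both summands of the matrix in degree \<open>k + N\<close> are congruent, by the same \<open>V\<close>, to those in degree
  \<open>N\<close>: the dissipation part by \<open>kyp_block_congruence\<close>, the multiplier part because the embedding of
  the multiplier commutes with truncation.\<close>

lemma lmi_mat_congruence:
  fixes A B C D P Q :: "real mat" and k :: nat
  assumes dims: "A \<in> carrier_mat n n" "B \<in> carrier_mat n w" "C \<in> carrier_mat z n" "D \<in> carrier_mat z w"
    and P: "P \<in> carrier_mat (n + N * w) (n + N * w)"
    and Q: "Q \<in> carrier_mat (N * w + w) (N * w + w)"
  defines "T \<equiv> drop_mat n (k * w) (N * w)"
    and "U \<equiv> drop_mat 0 (k * w) (N * w + w)"
    and "V \<equiv> drop_mat n (k * w) (N * w + w)"
  shows "lmi_mat A B C D \<alpha> (k + N) \<gamma> (transpose_mat T * P * T) (transpose_mat U * Q * U)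
    = transpose_mat V * lmi_mat A B C D \<alpha> N \<gamma> P Q * V"
proof -
  let ?p = "n + N * w + w" and ?q = "n + k * w + N * w + w"
  let ?R = "transpose_mat D * D - \<gamma>\<^sup>2 \<cdot>\<^sub>m 1\<^sub>m w"
  let ?kyp = "\<lambda>N P. four_block_mat
      (P * aug_A A \<alpha> N w + transpose_mat (aug_A A \<alpha> N w) * P
        + transpose_mat (aug_C C (N * w)) * aug_C C (N * w))
      (P * aug_B B N + transpose_mat (aug_C C (N * w)) * D)
      (transpose_mat (aug_B B N) * P + transpose_mat D * aug_C C (N * w)) ?R"
  let ?E1 = "drop_mat 0 n (N * w + w)" and ?E2 = "drop_mat 0 n (k * w + (N * w + w))"
  have dimAB: "dim_row A = n" "dim_col B = w"
    using dims by auto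
  have lmi1: "lmi_mat A B C D \<alpha> N \<gamma> P Q = ?kyp N P + transpose_mat ?E1 * Q * ?E1"
    by (simp only: lmi_mat_def Let_def embedding_eq_transpose_drop_mat Matrix.transpose_transpose dimAB)
  have lmi2: "lmi_mat A B C D \<alpha> (k + N) \<gamma> (transpose_mat T * P * T) (transpose_mat U * Q * U)
      = ?kyp (k + N) (transpose_mat T * P * T) + transpose_mat ?E2 * (transpose_mat U * Q * U) * ?E2"
    by (simp only: lmi_mat_def Let_def embedding_eq_transpose_drop_mat Matrix.transpose_transpose dimAB
        distrib_right add.assoc)
  have V: "V = four_block_mat T (0\<^sub>m (n + N * w) w) (0\<^sub>m w (n + k * w + N * w)) (1\<^sub>m w)"
    by (simp add: V_def T_def drop_mat_four_block)
  have carr: "aug_A A \<alpha> N w \<in> carrier_mat (n + N * w) (n + N * w)"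
    "aug_B B N \<in> carrier_mat (n + N * w) w" "aug_C C (N * w) \<in> carrier_mat z (n + N * w)"
    "aug_A A \<alpha> (k + N) w \<in> carrier_mat (n + k * w + N * w) (n + k * w + N * w)"
    "aug_B B (k + N) \<in> carrier_mat (n + k * w + N * w) w"
    "T \<in> carrier_mat (n + N * w) (n + k * w + N * w)" "?R \<in> carrier_mat w w"
    using dims by (auto simp: T_def distrib_right intro!: carrier_matI)
  have kyp: "?kyp (k + N) (transpose_mat T * P * T) = transpose_mat V * ?kyp N P * V"
    unfolding V
  proof (rule kyp_block_congruence[where z = z])
    show "T * aug_A A \<alpha> (k + N) w = aug_A A \<alpha> N w * T"
      unfolding T_def by (rule drop_mat_aug_A[OF dims(1)])
    show "T * aug_B B (k + N) = aug_B B N"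
      unfolding T_def by (rule drop_mat_aug_B[OF dims(2)])
    show "aug_C C ((k + N) * w) = aug_C C (N * w) * T"
      unfolding T_def using aug_C_drop_mat[OF dims(3)] by (simp add: distrib_right)
  qed (use dims P carr in simp_all)
  have UE: "U * ?E2 = ?E1 * V"
    unfolding U_def V_def by (rule drop_mat_compose)
  have UEt: "transpose_mat ?E2 * transpose_mat U = transpose_mat V * transpose_mat ?E1"
    unfolding U_def V_def by (rule transpose_drop_mat_compose)
  have "transpose_mat ?E2 * (transpose_mat U * Q * U) * ?E2
      = (transpose_mat ?E2 * transpose_mat U) * Q * (U * ?E2)"
    using Q by (simp add: assoc_mult_mat_dims U_def)
  also have "\<dots> = transpose_mat V * (transpose_mat ?E1 * Q * ?E1) * V"
    unfolding UE UEt using Q by (simp add: assoc_mult_mat_dims V_def)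
  finally have mult: "transpose_mat ?E2 * (transpose_mat U * Q * U) * ?E2
      = transpose_mat V * (transpose_mat ?E1 * Q * ?E1) * V" .
  have "?kyp N P \<in> carrier_mat ?p ?p" "transpose_mat ?E1 * Q * ?E1 \<in> carrier_mat ?p ?p"
    "V \<in> carrier_mat ?p ?q"
    using dims V carr(6) by (auto intro!: carrier_matI simp del: assoc_mult_mat)
  from congruence_add[OF this] show ?thesis
    unfolding lmi1 lmi2 kyp mult by (rule sym)
qed

lemma filter_bound_antimono:
  assumes dims: "A \<in> carrier_mat n n" "B \<in> carrier_mat n w" "C \<in> carrier_mat z n" "D \<in> carrier_mat z w"
    and K: "nonneg_congruence_closed K" and "N1 \<le> N2"
  shows "filter_bound K A B C D \<alpha> N2 \<le> filter_bound K A B C D \<alpha> N1"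
proof -
  obtain k where N2: "N2 = k + N1"
    using \<open>N1 \<le> N2\<close> by (metis add.commute le_Suc_ex)
  have "\<exists>Pa \<in> sym_mats (n + N2 * w). \<exists>Qa \<in> K (N2 * w + w). neg_semidef (lmi_mat A B C D \<alpha> N2 \<gamma> Pa Qa)"
    if P: "P \<in> sym_mats (n + N1 * w)" and Q: "Q \<in> K (N1 * w + w)"
      and neg: "neg_semidef (lmi_mat A B C D \<alpha> N1 \<gamma> P Q)" for \<gamma> P Q
  proof -
    define T where "T = drop_mat n (k * w) (N1 * w)"
    define U where "U = drop_mat 0 (k * w) (N1 * w + w)"
    define V where "V = drop_mat n (k * w) (N1 * w + w)"
    have N2w: "N2 * w = k * w + N1 * w"
      by (simp only: N2 distrib_right)
    have T: "T \<in> carrier_mat (n + N1 * w) (n + N2 * w)"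
      using drop_mat_carrier[of n "k * w" "N1 * w"] by (simp only: T_def N2w add.assoc)
    have U: "U \<in> carrier_mat (N1 * w + w) (N2 * w + w)" "0\<^sub>m (N1 * w + w) (N2 * w + w) \<le> U"
      using drop_mat_carrier[of 0 "k * w" "N1 * w + w"] drop_mat_nonneg[of 0 "N1 * w + w" "k * w"]
      by (simp_all only: U_def N2w add.assoc add_0)
    have Q': "Q \<in> sym_mats (N1 * w + w)" "transpose_mat U * Q * U \<in> K (N2 * w + w)"
      using K Q U unfolding nonneg_congruence_closed_def by blast+
    have eq: "lmi_mat A B C D \<alpha> N2 \<gamma> (transpose_mat T * P * T) (transpose_mat U * Q * U)
        = transpose_mat V * lmi_mat A B C D \<alpha> N1 \<gamma> P Q * V"
      unfolding N2 T_def U_def V_def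
      by (rule lmi_mat_congruence[OF dims]) (use P Q' in \<open>auto simp: sym_mats_def\<close>)
    have "lmi_mat A B C D \<alpha> N1 \<gamma> P Q \<in> carrier_mat (n + (N1 * w + w)) (n + (N1 * w + w))"
      using dims by (auto simp: lmi_mat_def Let_def append_rows_def)
    then have "neg_semidef (transpose_mat V * lmi_mat A B C D \<alpha> N1 \<gamma> P Q * V)"
      by (rule congruence_neg_semidef[OF neg]) (unfold V_def, rule drop_mat_carrier)
    then show ?thesis
      using congruence_sym_mats[OF P T] Q'(2) eq by metis
  qed
  then show ?thesis
    using dims unfolding filter_bound_def by (intro Inf_superset_mono image_mono) auto
qed

theorem theorem3:
  fixes A B C D :: "real mat" and n nw nz N1 N2 :: nat and \<alpha> :: real
  assumes "A \<in> carrier_mat n n" and "B \<in> carrier_mat n nw"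
    and "C \<in> carrier_mat nz n" and "D \<in> carrier_mat nz nw"
    and "hurwitz A" and "controllable A B"
    and "\<alpha> < 0"
    and "1 \<le> N1" and "N1 \<le> N2"
  shows "gamma_cop A B C D \<alpha> N2 \<le> gamma_cop A B C D \<alpha> N1 \<and>
         gamma_psd_nn A B C D \<alpha> N2 \<le> gamma_psd_nn A B C D \<alpha> N1"
  using filter_bound_antimono[OF assms(1-4) nonneg_congruence_closed_cop_cone assms(9)]
    filter_bound_antimono[OF assms(1-4) nonneg_congruence_closed_psd_plus_nn assms(9)]
  by (simp add: gamma_cop_def gamma_psd_nn_def)

end
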